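(* Let $n\ge 2$, $T=[a,b]\subset\mathbb{R}$, and consider the non-homogenous linear first order ODE system $$\frac{dx^{i}}{dt}=\sum_{k=1}^{n}a_{(1)k}^{(i)}(t)\,x^{k}+f_{(1)}^{(i)}(t),\qquad i=1,\dots,n,$$ i.e. the system $x_1^i=X_{(1)}^{(i)}(t,x)$ with $X_{(1)}^{(i)}(t,x)=\sum_{k=1}^n a_{(1)k}^{(i)}(t)x^k+f_{(1)}^{(i)}(t)$. Put $A_{(1)}=\big(a_{(1)j}^{(i)}(t)\big)_{i,j=1,\dots,n}$ ($i$ = row, $j$ = column), let ${}^{T}A_{(1)}$ be its transpose and $\dot A_{(1)}=\frac{d}{dt}A_{(1)}$. Then the geometrical objects on $J^1(T,\mathbb{R}^n)$ produced by this system (with respect to the pair of Euclidean metrics $\Delta=(1,\delta_{ij})$) are as follows. (i) The canonical non-linear connection is $\hat\Gamma=\big(0,\hat N_{(1)j}^{(i)}\big)$, where $$\hat N_{(1)}=\big(\hat N_{(1)j}^{(i)}\big)_{i,j=1,\dots,n}=-\tfrac12\big[A_{(1)}-{}^{T}A_{(1)}\big].$$ (ii) All adapted components of the canonical generalized Cartan connection $C\hat\Gamma$ vanish. (iii) The effective adapted components $\hat R_{(1)1j}^{(i)}$ of the torsion d-tensor of $C\hat\Gamma$ are the entries of the matrix $$\hat R_{(1)1}=\big(\hat R_{(1)1j}^{(i)}\big)_{i,j=1,\dots,n}=\tfrac12\big[\dot A_{(1)}-{}^{T}\dot A_{(1)}\big]$$ (the spatial torsion components $\hat R_{(1)jk}^{(i)}$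 being zero). (iv) All adapted components of the curvature d-tensor of $C\hat\Gamma$ vanish. (v) The geometric electromagnetic distinguished 2-form is $\hat F=\hat F_{(i)j}^{(1)}\,\delta x_1^i\wedge dx^j$, where $$\delta x_1^i=dx_1^i-\tfrac12\big[a_{(1)k}^{(i)}-a_{(1)i}^{(k)}\big]dx^k,\qquad i=1,\dots,n,$$ and $$\hat F^{(1)}=\big(\hat F_{(i)j}^{(1)}\big)_{i,j=1,\dots,n}=-\hat N_{(1)}=\tfrac12\big[A_{(1)}-{}^{T}A_{(1)}\big],\quad\text{that is}\quad \hat F_{(i)j}^{(1)}=\tfrac12\big[a_{(1)j}^{(i)}-a_{(1)i}^{(j)}\big].$$ (vi) The jet Yang-Mills energy is $$EYM^{\text{NHLODEs}}(t)=\frac14\sum_{i=1}^{n-1}\sum_{j=i+1}^{n}\big[a_{(1)j}^{(i)}-a_{(1)i}^{(j)}\big]^2 .$$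
   Context: Setting. $T=[a,b]\subset\mathbb{R}$ is a compact interval; $J^1(T,\mathbb{R}^n)\to T\times\mathbb{R}^n$, $n\ge2$, is the first order jet bundle with coordinates $(t,x^i,x_1^i)$, which transform by $\widetilde t=\widetilde t(t)$, $\widetilde x^i=\widetilde x^i(x^j)$, $\widetilde x_1^i=\frac{\partial\widetilde x^i}{\partial x^j}\frac{dt}{d\widetilde t}x_1^j$. Repeated indices are summed. All given functions are smooth. The system is described in a fixed convenient chart, in which the metrics are the Euclidean ones; its coefficients transform by $a_{(1)k}^{(i)}=\frac{\partial x^i}{\partial\widetilde x^j}\frac{d\widetilde t}{dt}\widetilde a_{(1)k}^{(j)}$ and $f_{(1)}^{(i)}=\frac{\partial x^i}{\partial\widetilde x^j}\frac{d\widetilde t}{dt}\widetilde f_{(1)}^{(j)}$. Geometrical objects produced by a first order ODE system. Let $X=(X_{(1)}^{(i)}(t,x))$ be a d-tensor field giving the system $x_1^i=X_{(1)}^{(i)}(t,x(t))$, $x_1^i=dx^i/dt$, and let $\mathcal P=(h_{11}(t),\varphi_{ij}(x))$ be a pair of Riemannian metrics on $T$ and $\mathbb{R}^n$ with Christoffel symbols $H_{11}^1(t)$, $\gamma_{jk}^i(x)$; $h^{11}=1/h_{11}$; $r^l_{ijk}$ is the curvature tensor of $\varphi$. Put $X_{(1)||j}^{(i)}=\frac{\partial X_{(1)}^{(i)}}{\partial x^j}+X_{(1)}^{(m)}\gamma_{mj}^i$, $\;X_{(1)||j//1}^{(i)}=\frac{\partial X_{(1)||j}^{(i)}}{\partial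 t}-X_{(1)||j}^{(i)}H_{11}^1$, $\;X_{(1)||j||k}^{(i)}=\frac{\partial X_{(1)||j}^{(i)}}{\partial x^k}+X_{(1)||j}^{(m)}\gamma_{mk}^i-X_{(1)||m}^{(i)}\gamma_{jk}^m$. The objects produced by the system and $\mathcal P$ (arising from the least squares Lagrangian $h^{11}\varphi_{ij}[x_1^i-X_{(1)}^{(i)}][x_1^j-X_{(1)}^{(j)}]$) are given by the following formulas, which are to be taken as their definitions: - Canonical non-linear connection: $(M_{(1)1}^{(i)},N_{(1)j}^{(i)})$ with $M_{(1)1}^{(i)}=-H_{11}^1x_1^i$ and $N_{(1)j}^{(i)}=\gamma_{jk}^ix_1^k-\frac12\big[X_{(1)||j}^{(i)}-\varphi^{ir}X_{(1)||r}^{(s)}\varphi_{sj}\big]$. - Canonical generalized Cartan connection: adapted components $(H_{11}^1,0,\gamma_{jk}^i,0)$. - Torsion d-tensor: its effective (i.e. possibly nonzero; all others are identically zero) adapted components are $R_{(1)1j}^{(i)}=\frac12\big[X_{(1)||j//1}^{(i)}-\varphi^{ir}X_{(1)||r//1}^{(s)}\varphi_{sj}\big]$ (temporal) and $R_{(1)jk}^{(i)}=r_{jkm}^ix_1^m-\frac12\big[X_{(1)||j||k}^{(i)}-\varphi^{ir}X_{(1)||r||k}^{(s)}\varphi_{sj}\big]$ (spatial). - Curvature d-tensor: its only effective adapted components are $R_{ijk}^l=r_{ijk}^l$. - Electromagnetic distinguished 2-form: $F=F_{(i)j}^{(1)}\delta x_1^i\wedge dx^j$, $\;\delta x_1^i=dx_1^i+M_{(1)1}^{(i)}dt+N_{(1)k}^{(i)}dx^k$,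 $\;F_{(i)j}^{(1)}=\frac{h^{11}}2\big[\varphi_{im}X_{(1)||j}^{(m)}-\varphi_{jm}X_{(1)||i}^{(m)}\big]$. - Jet Yang-Mills energy: $EYM=\sum_{i=1}^{n-1}\sum_{j=i+1}^n\big[F_{(i)j}^{(1)}\big]^2$. "Produced by the system" (with no metrics mentioned) means: produced by the system and the Euclidean pair $\mathcal P=\Delta=(h_{11}=1,\varphi_{ij}=\delta_{ij})$. *)

theory Defs
  imports "HOL-Analysis.Analysis"
begin

text \<open>
  Everything is written in one global chart \<open>(t, x, y)\<close> of the jet bundle, \<open>y\<close> standing for the
  velocity coordinates \<open>x\<^sub>1\<close>. The parameter \<open>T\<close> is the time interval; \<open>h\<close> and \<open>\<phi>\<close> are the
  coefficients of the metrics on \<open>T\<close> and on \<open>\<real>\<^sup>n\<close>, and \<open>X t x $ i\<close> is the right hand side of the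
  first order system. In all component functions with one upper index and
  several lower ones, the upper index is the first argument.
\<close>

text \<open>At the end points of \<open>T\<close> all time derivatives are one-sided. The function \<open>D k\<close> below is
  the \<open>k\<close>-th derivative.\<close>

definition smooth_curve_on :: "real set \<Rightarrow> (real \<Rightarrow> 'v::real_normed_vector) \<Rightarrow> bool" where
  "smooth_curve_on T g \<longleftrightarrow>
     (\<exists>D :: nat \<Rightarrow> real \<Rightarrow> 'v. (\<forall>t\<in>T. D 0 t = g t) \<and>
        (\<forall>k. \<forall>t\<in>T. (D k has_vector_derivative D (Suc k) t) (at t within T)))"

definition partial_t :: "real set \<Rightarrow> (real \<Rightarrow> real) \<Rightarrow> real \<Rightarrow> real" where
  "partial_t T g t = vector_derivative g (at t within T)"

definition partial_x :: "'n::finite \<Rightarrow> (real^'n \<Rightarrow> real) \<Rightarrow> real^'n \<Rightarrow> real" where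
  "partial_x j g x = deriv (\<lambda>s. g (x + s *\<^sub>R axis j 1)) 0"

definition christoffel_t :: "real set \<Rightarrow> (real \<Rightarrow> real) \<Rightarrow> real \<Rightarrow> real" where
  "christoffel_t T h t = 1 / (2 * h t) * partial_t T h t"

definition christoffel_x ::
    "(real^'n::finite \<Rightarrow> real^'n^'n) \<Rightarrow> 'n \<Rightarrow> 'n \<Rightarrow> 'n \<Rightarrow> real^'n \<Rightarrow> real" where
  "christoffel_x \<phi> i j k x =
     (\<Sum>m\<in>UNIV. matrix_inv (\<phi> x) $ i $ m / 2 *
        (partial_x k (\<lambda>z. \<phi> z $ j $ m) x + partial_x j (\<lambda>z. \<phi> z $ k $ m) x
          - partial_x m (\<lambda>z. \<phi> z $ j $ k) x))"

text \<open>Sign and index convention for \<open>r\<^sup>l\<^sub>i\<^sub>j\<^sub>k\<close>: skew-symmetric in the last two indices, as the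
  coefficient of \<open>\<partial>\<^sub>l\<close> in the curvature operator of \<open>(\<partial>\<^sub>k, \<partial>\<^sub>j)\<close> applied to \<open>\<partial>\<^sub>i\<close>.\<close>

definition riemann ::
    "(real^'n::finite \<Rightarrow> real^'n^'n) \<Rightarrow> 'n \<Rightarrow> 'n \<Rightarrow> 'n \<Rightarrow> 'n \<Rightarrow> real^'n \<Rightarrow> real" where
  "riemann \<phi> l i j k x =
     partial_x k (christoffel_x \<phi> l i j) x - partial_x j (christoffel_x \<phi> l i k) x
     + (\<Sum>m\<in>UNIV. christoffel_x \<phi> m i j x * christoffel_x \<phi> l m k x)
     - (\<Sum>m\<in>UNIV. christoffel_x \<phi> m i k x * christoffel_x \<phi> l m j x)"

definition euclid_h :: "real \<Rightarrow> real" where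
  "euclid_h = (\<lambda>t. 1)"

definition euclid_phi :: "real^'n::finite \<Rightarrow> real^'n^'n" where
  "euclid_phi = (\<lambda>x. mat 1)"

text \<open>\<open>X\<^sub>|\<^sub>|\<^sub>j\<close>, \<open>X\<^sub>|\<^sub>|\<^sub>j\<^sub>/\<^sub>/\<^sub>1\<close> and \<open>X\<^sub>|\<^sub>|\<^sub>j\<^sub>|\<^sub>|\<^sub>k\<close>, in this order.\<close>

definition cov_x ::
    "(real^'n::finite \<Rightarrow> real^'n^'n) \<Rightarrow> (real \<Rightarrow> real^'n \<Rightarrow> real^'n)
      \<Rightarrow> 'n \<Rightarrow> 'n \<Rightarrow> real \<Rightarrow> real^'n \<Rightarrow> real" where
  "cov_x \<phi> X i j t x =
     partial_x j (\<lambda>z. X t z $ i) x + (\<Sum>m\<in>UNIV. X t x $ m * christoffel_x \<phi> i m j x)"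

definition cov_x_t ::
    "real set \<Rightarrow> (real \<Rightarrow> real) \<Rightarrow> (real^'n::finite \<Rightarrow> real^'n^'n)
      \<Rightarrow> (real \<Rightarrow> real^'n \<Rightarrow> real^'n) \<Rightarrow> 'n \<Rightarrow> 'n \<Rightarrow> real \<Rightarrow> real^'n \<Rightarrow> real" where
  "cov_x_t T h \<phi> X i j t x =
     partial_t T (\<lambda>s. cov_x \<phi> X i j s x) t - cov_x \<phi> X i j t x * christoffel_t T h t"

definition cov_x_x ::
    "(real^'n::finite \<Rightarrow> real^'n^'n) \<Rightarrow> (real \<Rightarrow> real^'n \<Rightarrow> real^'n)
      \<Rightarrow> 'n \<Rightarrow> 'n \<Rightarrow> 'n \<Rightarrow> real \<Rightarrow> real^'n \<Rightarrow> real" where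
  "cov_x_x \<phi> X i j k t x =
     partial_x k (\<lambda>z. cov_x \<phi> X i j t z) x
     + (\<Sum>m\<in>UNIV. cov_x \<phi> X m j t x * christoffel_x \<phi> i m k x)
     - (\<Sum>m\<in>UNIV. cov_x \<phi> X i m t x * christoffel_x \<phi> m j k x)"

text \<open>\<open>B\<^sup>i\<^sub>j - \<phi>\<^sup>i\<^sup>r B\<^sup>s\<^sub>r \<phi>\<^sub>s\<^sub>j\<close>: \<open>B\<close> minus its adjoint with respect to \<open>\<phi>\<close>.\<close>

definition minus_adjoint ::
    "(real^'n::finite \<Rightarrow> real^'n^'n) \<Rightarrow> real^'n \<Rightarrow> ('n \<Rightarrow> 'n \<Rightarrow> real) \<Rightarrow> 'n \<Rightarrow> 'n \<Rightarrow> real" where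
  "minus_adjoint \<phi> x B i j =
     B i j - (\<Sum>r\<in>UNIV. \<Sum>s\<in>UNIV. matrix_inv (\<phi> x) $ i $ r * B s r * \<phi> x $ s $ j)"

definition nlc_M :: "real set \<Rightarrow> (real \<Rightarrow> real) \<Rightarrow> real \<Rightarrow> real^'n::finite \<Rightarrow> 'n \<Rightarrow> real" where
  "nlc_M T h t y i = - christoffel_t T h t * y $ i"

definition nlc_N ::
    "(real^'n::finite \<Rightarrow> real^'n^'n) \<Rightarrow> (real \<Rightarrow> real^'n \<Rightarrow> real^'n)
      \<Rightarrow> real \<Rightarrow> real^'n \<Rightarrow> real^'n \<Rightarrow> 'n \<Rightarrow> 'n \<Rightarrow> real" where
  "nlc_N \<phi> X t x y i j =
     (\<Sum>k\<in>UNIV. christoffel_x \<phi> i j k x * y $ k)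
     - 1 / 2 * minus_adjoint \<phi> x (\<lambda>s r. cov_x \<phi> X s r t x) i j"

definition nonlinear_connection ::
    "real set \<Rightarrow> (real \<Rightarrow> real) \<Rightarrow> (real^'n::finite \<Rightarrow> real^'n^'n)
      \<Rightarrow> (real \<Rightarrow> real^'n \<Rightarrow> real^'n) \<Rightarrow> real \<Rightarrow> real^'n \<Rightarrow> real^'n
      \<Rightarrow> (real^'n) \<times> (real^'n^'n)" where
  "nonlinear_connection T h \<phi> X t x y =
     ((\<chi> i. nlc_M T h t y i), (\<chi> i j. nlc_N \<phi> X t x y i j))"

text \<open>The adapted components \<open>(H\<^sup>1\<^sub>1\<^sub>1, G\<^sup>k\<^sub>j\<^sub>1, L\<^sup>i\<^sub>j\<^sub>k, C\<^sup>i\<^sub>j\<^sub>(\<^sub>k\<^sub>))\<close> of a linear connection of Cartan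
  type at a point.\<close>

record 'n adapted_connection =
  conn_H :: real
  conn_G :: "'n \<Rightarrow> 'n \<Rightarrow> real"
  conn_L :: "'n \<Rightarrow> 'n \<Rightarrow> 'n \<Rightarrow> real"
  conn_C :: "'n \<Rightarrow> 'n \<Rightarrow> 'n \<Rightarrow> real"

definition cartan_connection ::
    "real set \<Rightarrow> (real \<Rightarrow> real) \<Rightarrow> (real^'n::finite \<Rightarrow> real^'n^'n)
      \<Rightarrow> real \<Rightarrow> real^'n \<Rightarrow> 'n adapted_connection" where
  "cartan_connection T h \<phi> t x =
     \<lparr> conn_H = christoffel_t T h t,
       conn_G = (\<lambda>k j. 0),
       conn_L = (\<lambda>i j k. christoffel_x \<phi> i j k x),
       conn_C = (\<lambda>i j k. 0) \<rparr>"

text \<open>Indices of the adapted frame \<open>\<delta>/\<delta>t, \<delta>/\<delta>x\<^sup>i, \<partial>/\<partial>y\<^sup>i\<close>.\<close>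

datatype 'n adapted_index = Temporal | Horizontal 'n | Vertical 'n

definition torsion_t ::
    "real set \<Rightarrow> (real \<Rightarrow> real) \<Rightarrow> (real^'n::finite \<Rightarrow> real^'n^'n)
      \<Rightarrow> (real \<Rightarrow> real^'n \<Rightarrow> real^'n) \<Rightarrow> real \<Rightarrow> real^'n \<Rightarrow> 'n \<Rightarrow> 'n \<Rightarrow> real" where
  "torsion_t T h \<phi> X t x i j =
     1 / 2 * minus_adjoint \<phi> x (\<lambda>s r. cov_x_t T h \<phi> X s r t x) i j"

definition torsion_x ::
    "(real^'n::finite \<Rightarrow> real^'n^'n) \<Rightarrow> (real \<Rightarrow> real^'n \<Rightarrow> real^'n)
      \<Rightarrow> real \<Rightarrow> real^'n \<Rightarrow> real^'n \<Rightarrow> 'n \<Rightarrow> 'n \<Rightarrow> 'n \<Rightarrow> real" where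
  "torsion_x \<phi> X t x y i j k =
     (\<Sum>m\<in>UNIV. riemann \<phi> i j k m x * y $ m)
     - 1 / 2 * minus_adjoint \<phi> x (\<lambda>s r. cov_x_x \<phi> X s r k t x) i j"

text \<open>The lower pair
  (horizontal, temporal) carries the opposite of (temporal, horizontal), a torsion being
  skew-symmetric.\<close>

definition torsion ::
    "real set \<Rightarrow> (real \<Rightarrow> real) \<Rightarrow> (real^'n::finite \<Rightarrow> real^'n^'n)
      \<Rightarrow> (real \<Rightarrow> real^'n \<Rightarrow> real^'n) \<Rightarrow> real \<Rightarrow> real^'n \<Rightarrow> real^'n
      \<Rightarrow> 'n adapted_index \<Rightarrow> 'n adapted_index \<Rightarrow> 'n adapted_index \<Rightarrow> real" where
  "torsion T h \<phi> X t x y U B C =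
     (case (U, B, C) of
        (Vertical i, Temporal, Horizontal j) \<Rightarrow> torsion_t T h \<phi> X t x i j
      | (Vertical i, Horizontal j, Temporal) \<Rightarrow> - torsion_t T h \<phi> X t x i j
      | (Vertical i, Horizontal j, Horizontal k) \<Rightarrow> torsion_x \<phi> X t x y i j k
      | _ \<Rightarrow> 0)"

text \<open>The coefficients of the curvature on the vertical frame repeat those on the horizontal
  frame; following the usual counting of effective components, only the latter are entered.\<close>

definition curvature ::
    "(real^'n::finite \<Rightarrow> real^'n^'n) \<Rightarrow> real^'n
      \<Rightarrow> 'n adapted_index \<Rightarrow> 'n adapted_index \<Rightarrow> 'n adapted_index \<Rightarrow> 'n adapted_index \<Rightarrow> real" where
  "curvature \<phi> x U B C D =
     (case (U, B, C, D) of
        (Horizontal l, Horizontal i, Horizontal j, Horizontal k) \<Rightarrow> riemann \<phi> l i j k x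
      | _ \<Rightarrow> 0)"

text \<open>Tangent vectors of the jet bundle at a point are given by their components with respect to
  the natural frame \<open>\<partial>/\<partial>t, \<partial>/\<partial>x\<^sup>i, \<partial>/\<partial>y\<^sup>i\<close>; forms at a point are functions of tangent vectors.\<close>

type_synonym 'n jet_tangent = "real \<times> (real^'n) \<times> (real^'n)"

definition form_dt :: "'n::finite jet_tangent \<Rightarrow> real" where
  "form_dt v = fst v"

definition form_dx :: "'n \<Rightarrow> 'n::finite jet_tangent \<Rightarrow> real" where
  "form_dx i v = fst (snd v) $ i"

definition form_dy :: "'n \<Rightarrow> 'n::finite jet_tangent \<Rightarrow> real" where
  "form_dy i v = snd (snd v) $ i"

definition wedge :: "('v \<Rightarrow> real) \<Rightarrow> ('v \<Rightarrow> real) \<Rightarrow> 'v \<Rightarrow> 'v \<Rightarrow> real" where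
  "wedge \<alpha> \<beta> v w = \<alpha> v * \<beta> w - \<alpha> w * \<beta> v"

definition form_delta_y ::
    "real set \<Rightarrow> (real \<Rightarrow> real) \<Rightarrow> (real^'n::finite \<Rightarrow> real^'n^'n)
      \<Rightarrow> (real \<Rightarrow> real^'n \<Rightarrow> real^'n) \<Rightarrow> real \<Rightarrow> real^'n \<Rightarrow> real^'n
      \<Rightarrow> 'n \<Rightarrow> 'n jet_tangent \<Rightarrow> real" where
  "form_delta_y T h \<phi> X t x y i =
     (\<lambda>v. form_dy i v + nlc_M T h t y i * form_dt v
        + (\<Sum>k\<in>UNIV. nlc_N \<phi> X t x y i k * form_dx k v))"

definition em_component ::
    "(real \<Rightarrow> real) \<Rightarrow> (real^'n::finite \<Rightarrow> real^'n^'n)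
      \<Rightarrow> (real \<Rightarrow> real^'n \<Rightarrow> real^'n) \<Rightarrow> real \<Rightarrow> real^'n \<Rightarrow> 'n \<Rightarrow> 'n \<Rightarrow> real" where
  "em_component h \<phi> X t x i j =
     (1 / h t) / 2 *
       ((\<Sum>m\<in>UNIV. \<phi> x $ i $ m * cov_x \<phi> X m j t x)
        - (\<Sum>m\<in>UNIV. \<phi> x $ j $ m * cov_x \<phi> X m i t x))"

definition em_form ::
    "real set \<Rightarrow> (real \<Rightarrow> real) \<Rightarrow> (real^'n::finite \<Rightarrow> real^'n^'n)
      \<Rightarrow> (real \<Rightarrow> real^'n \<Rightarrow> real^'n) \<Rightarrow> real \<Rightarrow> real^'n \<Rightarrow> real^'n
      \<Rightarrow> 'n jet_tangent \<Rightarrow> 'n jet_tangent \<Rightarrow> real" where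
  "em_form T h \<phi> X t x y =
     (\<lambda>v w. \<Sum>i\<in>UNIV. \<Sum>j\<in>UNIV.
        em_component h \<phi> X t x i j * wedge (form_delta_y T h \<phi> X t x y i) (form_dx j) v w)"

text \<open>The linear order on the index type plays the role of \<open>1 < 2 < \<dots> < n\<close>; the inner sum is
  empty for the greatest index.\<close>

definition yang_mills_energy ::
    "(real \<Rightarrow> real)
      \<Rightarrow> (real^'n::{finite,linorder} \<Rightarrow> real^'n::{finite,linorder}^'n::{finite,linorder})
      \<Rightarrow> (real \<Rightarrow> real^'n::{finite,linorder} \<Rightarrow> real^'n::{finite,linorder})
      \<Rightarrow> real \<Rightarrow> real^'n::{finite,linorder} \<Rightarrow> real" where
  "yang_mills_energy h \<phi> X t x =
     (\<Sum>i\<in>UNIV. \<Sum>j\<in>{i<..}. (em_component h \<phi> X t x i j)\<^sup>2)"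

end

theory Submission
  imports Defs
begin

text \<open>
  For Euclidean metrics all Christoffel symbols vanish and the metric adjoint of a matrix is its
  transpose. Hence the Cartan connection and the curvature vanish, and the other objects produced by
  a first order system \<open>X\<close> are built from the skew part of the Jacobian matrix \<open>\<partial>X\<^sup>i/\<partial>x\<^sup>j\<close> and
  of its derivatives; this holds for arbitrary \<open>X\<close>. The non-linear connection
  and the electromagnetic components are the skew part
  itself up to the factors \<open>-1/2\<close> and \<open>1/2\<close>, the temporal torsion comes from its \<open>t\<close>-derivative and
  the spatial torsion from its \<open>x\<close>-derivatives.

  For a linear system the Jacobian matrix is the coefficient matrix \<open>A t\<close>
  (lemma \<open>cov_x_linear\<close>). It does not depend on \<open>x\<close>, so the spatial torsion vanishes, and
  its time derivative is computed entrywise (lemma \<open>cov_x_t_linear\<close>).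
\<close>

section \<open>Geometry of the Euclidean pair of metrics\<close>

lemma partial_x_const [simp]: "partial_x j (\<lambda>z. c) x = 0"
  by (simp add: partial_x_def)

text \<open>At an isolated point of \<open>T\<close> a derivative within \<open>T\<close> is not unique and
  \<open>partial_t\<close> denotes an arbitrary number, even for a constant function.\<close>

lemma christoffel_t_euclid:
  assumes "at t within T \<noteq> bot"
  shows "christoffel_t T euclid_h t = 0"
proof -
  have "vector_derivative (\<lambda>s. 1 :: real) (at t within T) = 0"
    by (intro vector_derivative_within[OF assms] has_vector_derivative_const)
  then show ?thesis
    by (simp add: christoffel_t_def partial_t_def euclid_h_def)
qed

lemma christoffel_x_euclid [simp]: "christoffel_x euclid_phi i j k x = 0"
  by (simp add: christoffel_x_def euclid_phi_def)

lemma riemann_euclid [simp]: "riemann euclid_phi l i j k x = 0"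
proof -
  have "christoffel_x euclid_phi p q r = (\<lambda>z. 0)" for p q r :: 'a
    by (rule ext) simp
  then show ?thesis
    by (simp add: riemann_def)
qed

lemma matrix_inv_mat_1: "matrix_inv (mat 1 :: real^'n^'n) = mat 1"
proof -
  have "\<exists>B. mat 1 ** B = (mat 1 :: real^'n^'n) \<and> B ** mat 1 = (mat 1 :: real^'n^'n)"
    by (rule exI[of _ "mat 1"]) simp
  then have "mat 1 ** matrix_inv (mat 1) = (mat 1 :: real^'n^'n)"
    unfolding matrix_inv_def by (rule someI2_ex) blast
  then show ?thesis
    by simp
qed

text \<open>Both contractions with the metric collapse, so the adjoint is the transpose.\<close>

lemma minus_adjoint_euclid [simp]: "minus_adjoint euclid_phi x B i j = B i j - B j i"
proof -
  have "(\<Sum>r\<in>UNIV. \<Sum>s\<in>UNIV. (mat 1 :: real^'a^'a) $ i $ r * B s r * (mat 1 :: real^'a^'a) $ s $ j)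
      = (\<Sum>r\<in>UNIV. if i = r then \<Sum>s\<in>UNIV. if s = j then B s r else 0 else 0)"
    by (intro sum.cong refl) (auto simp: mat_def if_distrib cong: if_cong)
  also have "\<dots> = B j i"
    by simp
  finally show ?thesis
    by (simp add: minus_adjoint_def euclid_phi_def matrix_inv_mat_1)
qed

lemma nlc_M_euclid: "at t within T \<noteq> bot \<Longrightarrow> nlc_M T euclid_h t y i = 0"
  by (simp add: nlc_M_def christoffel_t_euclid)

lemma nlc_N_euclid:
  "nlc_N euclid_phi X t x y i j
     = - 1 / 2 * (cov_x euclid_phi X i j t x - cov_x euclid_phi X j i t x)"
  by (simp add: nlc_N_def)

lemma torsion_t_euclid:
  "torsion_t T h euclid_phi X t x i j
     = 1 / 2 * (cov_x_t T h euclid_phi X i j t x - cov_x_t T h euclid_phi X j i t x)"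
  by (simp add: torsion_t_def)

lemma torsion_x_euclid:
  "torsion_x euclid_phi X t x y i j k
     = - 1 / 2 * (cov_x_x euclid_phi X i j k t x - cov_x_x euclid_phi X j i k t x)"
  by (simp add: torsion_x_def)

lemma em_component_euclid:
  "em_component euclid_h euclid_phi X t x i j
     = 1 / 2 * (cov_x euclid_phi X i j t x - cov_x euclid_phi X j i t x)"
proof -
  have "(\<Sum>m\<in>UNIV. (mat 1 :: real^'a^'a) $ p $ m * g m) = g p" for p and g :: "'a \<Rightarrow> real"
  proof -
    have "(\<Sum>m\<in>UNIV. (mat 1 :: real^'a^'a) $ p $ m * g m) = (\<Sum>m\<in>UNIV. if p = m then g m else 0)"
      by (intro sum.cong refl) (simp add: mat_def)
    then show ?thesis
      by simp
  qed
  then show ?thesis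
    by (simp add: em_component_def euclid_h_def euclid_phi_def)
qed

lemma curvature_euclid: "curvature euclid_phi x U B C D = 0"
  by (simp add: curvature_def split: adapted_index.split)

section \<open>Linear systems\<close>

text \<open>Along the line \<open>s \<mapsto> x + s e\<^sub>j\<close> the \<open>i\<close>-th component of the system is affine in \<open>s\<close>,
  with slope \<open>A\<^sup>i\<^sub>j\<close>.\<close>

lemma cov_x_linear:
  fixes A :: "real^'n::finite^'n"
  assumes "\<And>z. X t z $ i = (\<Sum>k\<in>UNIV. A $ i $ k * z $ k) + c"
  shows "cov_x euclid_phi X i j t x = A $ i $ j"
proof -
  have "(\<Sum>k\<in>UNIV. A $ i $ k * (x + s *\<^sub>R axis j 1) $ k)
      = (\<Sum>k\<in>UNIV. A $ i $ k * x $ k) + s * A $ i $ j" for s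
  proof -
    have "(\<Sum>k\<in>UNIV. A $ i $ k * (x + s *\<^sub>R axis j 1) $ k)
        = (\<Sum>k\<in>UNIV. A $ i $ k * x $ k + (if k = j then s * A $ i $ k else 0))"
      by (intro sum.cong refl) (simp add: axis_def algebra_simps)
    then show ?thesis
      by (simp add: sum.distrib)
  qed
  then have "(\<lambda>s. X t (x + s *\<^sub>R axis j 1) $ i)
      = (\<lambda>s. ((\<Sum>k\<in>UNIV. A $ i $ k * x $ k) + s * A $ i $ j) + c)"
    by (simp add: assms)
  moreover have "((\<lambda>s. ((\<Sum>k\<in>UNIV. A $ i $ k * x $ k) + s * A $ i $ j) + c)
      has_field_derivative A $ i $ j) (at 0)"
    by (auto intro!: derivative_eq_intros)
  ultimately have "partial_x j (\<lambda>z. X t z $ i) x = A $ i $ j"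
    by (simp add: partial_x_def DERIV_imp_deriv)
  then show ?thesis
    by (simp add: cov_x_def)
qed

lemma cov_x_x_linear:
  fixes A :: "real^'n::finite^'n"
  assumes "\<And>z. X t z $ i = (\<Sum>k\<in>UNIV. A $ i $ k * z $ k) + c"
  shows "cov_x_x euclid_phi X i j k t x = 0"
proof -
  have "(\<lambda>z. cov_x euclid_phi X i j t z) = (\<lambda>z. A $ i $ j)"
    using cov_x_linear[of X t i A c, OF assms] by auto
  then show ?thesis
    by (simp add: cov_x_x_def)
qed

text \<open>A derivative within \<open>T\<close> at a point of \<open>T\<close> sees the system on \<open>T\<close> only, so linearity
  there suffices.\<close>

lemma cov_x_t_linear:
  fixes A :: "real \<Rightarrow> real^'n::finite^'n"
  assumes t: "t \<in> T" "at t within T \<noteq> bot"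
    and A: "(A has_vector_derivative A') (at t within T)"
    and X: "\<And>s z. s \<in> T \<Longrightarrow> X s z $ i = (\<Sum>k\<in>UNIV. A s $ i $ k * z $ k) + c s"
  shows "cov_x_t T euclid_h euclid_phi X i j t x = A' $ i $ j"
proof -
  have "((\<lambda>s. A s $ i $ j) has_vector_derivative A' $ i $ j) (at t within T)"
    by (intro bounded_linear.has_vector_derivative[OF bounded_linear_vec_nth] A)
  then have "((\<lambda>s. cov_x euclid_phi X i j s x) has_vector_derivative A' $ i $ j)
      (at t within T)"
    by (rule has_vector_derivative_transform[OF t(1), rotated])
      (simp add: cov_x_linear X)
  then have "partial_t T (\<lambda>s. cov_x euclid_phi X i j s x) t = A' $ i $ j"
    unfolding partial_t_def by (rule vector_derivative_within[OF t(2)])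
  then show ?thesis
    by (simp add: cov_x_t_def christoffel_t_euclid t(2))
qed

lemma smooth_curve_on_has_vector_derivative:
  assumes "smooth_curve_on T g" "t \<in> T"
  shows "(g has_vector_derivative vector_derivative g (at t within T)) (at t within T)"
proof -
  obtain D where D: "\<forall>s\<in>T. D 0 s = g s"
      "(D 0 has_vector_derivative D (Suc 0) t) (at t within T)"
    using assms unfolding smooth_curve_on_def by blast
  then have "(g has_vector_derivative D (Suc 0) t) (at t within T)"
    using has_vector_derivative_transform[OF assms(2), of g "D 0"] by auto
  then have "g differentiable (at t within T)"
    by (rule differentiableI_vector)
  then show ?thesis
    by (simp add: vector_derivative_works)
qed

section \<open>The objects produced by a linear system\<close>

theorem theorem3p2:
  fixes a b :: real
    and A :: "real \<Rightarrow> real^'n::{finite,linorder}^'n::{finite,linorder}"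
    and f :: "real \<Rightarrow> real^'n::{finite,linorder}"
    and X :: "real \<Rightarrow> real^'n::{finite,linorder} \<Rightarrow> real^'n::{finite,linorder}"
  assumes n: "CARD('n) \<ge> 2"
    and ab: "a < b"
    and A_smooth: "smooth_curve_on {a..b} A"
    and f_smooth: "smooth_curve_on {a..b} f"
    and X: "\<And>t x i. t \<in> {a..b} \<Longrightarrow> X t x $ i = (\<Sum>k\<in>UNIV. A t $ i $ k * x $ k) + f t $ i"
  shows
    "\<forall>t\<in>{a..b}. \<forall>x y :: real^'n::{finite,linorder}.
       (nonlinear_connection {a..b} euclid_h euclid_phi X t x y
         = (0, (- 1 / 2) *\<^sub>R (A t - transpose (A t))))
       \<and>
       (conn_H (cartan_connection {a..b} euclid_h euclid_phi t x) = 0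
       \<and> (\<forall>k j. conn_G (cartan_connection {a..b} euclid_h euclid_phi t x) k j = 0)
       \<and> (\<forall>i j k. conn_L (cartan_connection {a..b} euclid_h euclid_phi t x) i j k = 0)
       \<and> (\<forall>i j k. conn_C (cartan_connection {a..b} euclid_h euclid_phi t x) i j k = 0))
       \<and>
       ((\<chi> i j. torsion {a..b} euclid_h euclid_phi X t x y (Vertical i) Temporal (Horizontal j))
         = (1 / 2) *\<^sub>R (vector_derivative A (at t within {a..b})
                      - transpose (vector_derivative A (at t within {a..b})))
       \<and> (\<forall>i j k. torsion {a..b} euclid_h euclid_phi X t x y
                    (Vertical i) (Horizontal j) (Horizontal k) = 0)
       \<and> (\<forall>U B C. torsion {a..b} euclid_h euclid_phi X t x y U B C \<noteq> 0 \<longrightarrow>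
            (\<exists>i j. U = Vertical i \<and>
               (B = Temporal \<and> C = Horizontal j \<or> B = Horizontal j \<and> C = Temporal))))
       \<and>
       (\<forall>U B C D. curvature euclid_phi x U B C D = 0)
       \<and>
       ((\<forall>i. form_delta_y {a..b} euclid_h euclid_phi X t x y i
          = (\<lambda>v. form_dy i v - 1 / 2 * (\<Sum>k\<in>UNIV. (A t $ i $ k - A t $ k $ i) * form_dx k v)))
       \<and> em_form {a..b} euclid_h euclid_phi X t x y
          = (\<lambda>v w. \<Sum>i\<in>UNIV. \<Sum>j\<in>UNIV.
               1 / 2 * (A t $ i $ j - A t $ j $ i) *
               wedge (\<lambda>u. form_dy i u
                        - 1 / 2 * (\<Sum>k\<in>UNIV. (A t $ i $ k - A t $ k $ i) * form_dx k u))
                     (form_dx j) v w)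
       \<and> (\<chi> i j. em_component euclid_h euclid_phi X t x i j)
          = - snd (nonlinear_connection {a..b} euclid_h euclid_phi X t x y)
       \<and> (\<chi> i j. em_component euclid_h euclid_phi X t x i j)
          = (1 / 2) *\<^sub>R (A t - transpose (A t))
       \<and> (\<forall>i j. em_component euclid_h euclid_phi X t x i j = 1 / 2 * (A t $ i $ j - A t $ j $ i)))
       \<and>
       (yang_mills_energy euclid_h euclid_phi X t x
         = 1 / 4 * (\<Sum>i\<in>UNIV. \<Sum>j\<in>{i<..}. (A t $ i $ j - A t $ j $ i)\<^sup>2))"
proof (intro ballI allI)
  fix t and x y :: "real^'n::{finite,linorder}"
  assume t: "t \<in> {a..b}"
  (* The time derivatives at t are unique because a < b. *)
  have nontrivial: "at t within {a..b} \<noteq> bot"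
    using ab t by (simp add: trivial_limit_within)
  define A' where "A' = vector_derivative A (at t within {a..b})"
  have cov: "cov_x euclid_phi X i j t x = A t $ i $ j" for i j
    using X[OF t] by (rule cov_x_linear)
  have cov_t: "cov_x_t {a..b} euclid_h euclid_phi X i j t x = A' $ i $ j" for i j
    using t nontrivial smooth_curve_on_has_vector_derivative[OF A_smooth t, folded A'_def] X
    by (rule cov_x_t_linear)
  have N: "nlc_N euclid_phi X t x y i j = - 1 / 2 * (A t $ i $ j - A t $ j $ i)" for i j
    by (simp add: nlc_N_euclid cov)
  have connection: "nonlinear_connection {a..b} euclid_h euclid_phi X t x y
      = (0, (- 1 / 2) *\<^sub>R (A t - transpose (A t)))"
    by (simp add: nonlinear_connection_def nlc_M_euclid nontrivial N vec_eq_iff transpose_def)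
  have tor_t: "torsion_t {a..b} euclid_h euclid_phi X t x i j = 1 / 2 * (A' $ i $ j - A' $ j $ i)"
    for i j
    by (simp add: torsion_t_euclid cov_t)
  have tor_x: "torsion_x euclid_phi X t x y i j k = 0" for i j k
    using cov_x_x_linear[of X t _ "A t", OF X[OF t]] by (simp add: torsion_x_euclid)
  have torsion_matrix:
    "(\<chi> i j. torsion {a..b} euclid_h euclid_phi X t x y (Vertical i) Temporal (Horizontal j))
       = (1 / 2) *\<^sub>R (A' - transpose A')"
    by (simp add: torsion_def tor_t vec_eq_iff transpose_def)
  have torsion_spatial:
    "torsion {a..b} euclid_h euclid_phi X t x y (Vertical i) (Horizontal j) (Horizontal k) = 0"
    for i j k
    by (simp add: torsion_def tor_x)
  have torsion_effective: "\<exists>i j. U = Vertical i \<and>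
      (B = Temporal \<and> C = Horizontal j \<or> B = Horizontal j \<and> C = Temporal)"
    if "torsion {a..b} euclid_h euclid_phi X t x y U B C \<noteq> 0" for U B C
    using that by (auto simp: torsion_def tor_x split: adapted_index.splits)
  have delta_y: "form_delta_y {a..b} euclid_h euclid_phi X t x y i
      = (\<lambda>v. form_dy i v - 1 / 2 * (\<Sum>k\<in>UNIV. (A t $ i $ k - A t $ k $ i) * form_dx k v))" for i
    by (simp add: form_delta_y_def nlc_M_euclid nontrivial N sum_distrib_left sum_negf)
  have em: "em_component euclid_h euclid_phi X t x i j = 1 / 2 * (A t $ i $ j - A t $ j $ i)"
    for i j
    by (simp add: em_component_euclid cov)
  have em_matrix: "(\<chi> i j. em_component euclid_h euclid_phi X t x i j)
      = (1 / 2) *\<^sub>R (A t - transpose (A t))"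
    by (simp add: em vec_eq_iff transpose_def)
  have energy: "yang_mills_energy euclid_h euclid_phi X t x
      = 1 / 4 * (\<Sum>i\<in>UNIV. \<Sum>j\<in>{i<..}. (A t $ i $ j - A t $ j $ i)\<^sup>2)"
    by (simp add: yang_mills_energy_def em power_divide sum_divide_distrib)
  show "(nonlinear_connection {a..b} euclid_h euclid_phi X t x y
         = (0, (- 1 / 2) *\<^sub>R (A t - transpose (A t))))
       \<and>
       (conn_H (cartan_connection {a..b} euclid_h euclid_phi t x) = 0
       \<and> (\<forall>k j. conn_G (cartan_connection {a..b} euclid_h euclid_phi t x) k j = 0)
       \<and> (\<forall>i j k. conn_L (cartan_connection {a..b} euclid_h euclid_phi t x) i j k = 0)
       \<and> (\<forall>i j k. conn_C (cartan_connection {a..b} euclid_h euclid_phi t x) i j k = 0))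
       \<and>
       ((\<chi> i j. torsion {a..b} euclid_h euclid_phi X t x y (Vertical i) Temporal (Horizontal j))
         = (1 / 2) *\<^sub>R (vector_derivative A (at t within {a..b})
                      - transpose (vector_derivative A (at t within {a..b})))
       \<and> (\<forall>i j k. torsion {a..b} euclid_h euclid_phi X t x y
                    (Vertical i) (Horizontal j) (Horizontal k) = 0)
       \<and> (\<forall>U B C. torsion {a..b} euclid_h euclid_phi X t x y U B C \<noteq> 0 \<longrightarrow>
            (\<exists>i j. U = Vertical i \<and>
               (B = Temporal \<and> C = Horizontal j \<or> B = Horizontal j \<and> C = Temporal))))
       \<and>
       (\<forall>U B C D. curvature euclid_phi x U B C D = 0)
       \<and>
       ((\<forall>i. form_delta_y {a..b} euclid_h euclid_phi X t x y i
          = (\<lambda>v. form_dy i v - 1 / 2 * (\<Sum>k\<in>UNIV. (A t $ i $ k - A t $ k $ i) * form_dx k v)))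
       \<and> em_form {a..b} euclid_h euclid_phi X t x y
          = (\<lambda>v w. \<Sum>i\<in>UNIV. \<Sum>j\<in>UNIV.
               1 / 2 * (A t $ i $ j - A t $ j $ i) *
               wedge (\<lambda>u. form_dy i u
                        - 1 / 2 * (\<Sum>k\<in>UNIV. (A t $ i $ k - A t $ k $ i) * form_dx k u))
                     (form_dx j) v w)
       \<and> (\<chi> i j. em_component euclid_h euclid_phi X t x i j)
          = - snd (nonlinear_connection {a..b} euclid_h euclid_phi X t x y)
       \<and> (\<chi> i j. em_component euclid_h euclid_phi X t x i j)
          = (1 / 2) *\<^sub>R (A t - transpose (A t))
       \<and> (\<forall>i j. em_component euclid_h euclid_phi X t x i j = 1 / 2 * (A t $ i $ j - A t $ j $ i)))
       \<and>
       (yang_mills_energy euclid_h euclid_phi X t x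
         = 1 / 4 * (\<Sum>i\<in>UNIV. \<Sum>j\<in>{i<..}. (A t $ i $ j - A t $ j $ i)\<^sup>2))"
    unfolding connection A'_def[symmetric] torsion_matrix em_matrix
    using torsion_spatial torsion_effective
    by (intro conjI) (simp_all add: em energy delta_y em_form_def cartan_connection_def
        christoffel_t_euclid nontrivial curvature_euclid)
qed

end
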